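(* Let $d\ge 1$ and $q\ge 2$ be integers. The Hamming graph $H(d,q)$ is periodic if and only if $(d,q)\in\{(1,2),(1,3),(2,2),(3,3),(4,2)\}$.
   Context: The Hamming graph $H(d,q)$: let $F$ be a set with $q$ elements; the vertex set is $F^d$, and two vertices $x=(x_1,\dots,x_d)$, $y=(y_1,\dots,y_d)$ are adjacent iff they differ in exactly one coordinate. For a finite simple graph $G=(V,E)$, let $\mathcal{A}(G)=\{(u,v),(v,u) : uv\in E\}$ be its set of symmetric arcs; for an arc $e=(u,v)$ write $o(e)=u$, $t(e)=v$, $e^{-1}=(v,u)$. The Grover transfer matrix $U=U(G)$ is indexed by $\mathcal{A}(G)$ with $U_{e,f}=2/\deg(t(f))$ if $t(f)=o(e)$ and $e\neq f^{-1}$; $U_{e,f}=2/\deg(t(f))-1$ if $e=f^{-1}$; $U_{e,f}=0$ otherwise. $G$ is periodic if $U^k=I$ for some positive integer $k$. *)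

theory Defs
  imports Complex_Main "HOL-Library.FuncSet" "Graph_Theory.Pair_Digraph"
begin

text \<open>
  A finite simple graph is a \<^locale>\<open>pair_graph\<close>: a finite loop-free digraph without parallel
  arcs whose arc set is symmetric. Its field \<^const>\<open>parcs\<close> is the set of symmetric arcs; for an arc
  \<open>e\<close> the origin, terminus and inverse are \<open>fst e\<close>, \<open>snd e\<close> and \<open>prod.swap e\<close>, and by symmetry
  \<^const>\<open>out_degree\<close> is the degree.
\<close>

text \<open>
  A matrix with rows and columns indexed by a finite set \<open>A\<close> is a function of type
  \<open>'i \<Rightarrow> 'i \<Rightarrow> real\<close>; only its values on \<open>A \<times> A\<close> are meaningful.
\<close>

definition idx_mat_one :: "'i \<Rightarrow> 'i \<Rightarrow> real" where
  "idx_mat_one e f = (if e = f then 1 else 0)"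

definition idx_mat_mult ::
  "'i set \<Rightarrow> ('i \<Rightarrow> 'i \<Rightarrow> real) \<Rightarrow> ('i \<Rightarrow> 'i \<Rightarrow> real) \<Rightarrow> 'i \<Rightarrow> 'i \<Rightarrow> real" where
  "idx_mat_mult A M N e f = (\<Sum>g\<in>A. M e g * N g f)"

primrec idx_mat_pow :: "'i set \<Rightarrow> ('i \<Rightarrow> 'i \<Rightarrow> real) \<Rightarrow> nat \<Rightarrow> 'i \<Rightarrow> 'i \<Rightarrow> real" where
  "idx_mat_pow A M 0 = idx_mat_one"
| "idx_mat_pow A M (Suc k) = idx_mat_mult A M (idx_mat_pow A M k)"

definition grover :: "'v pair_pre_digraph \<Rightarrow> 'v \<times> 'v \<Rightarrow> 'v \<times> 'v \<Rightarrow> real" where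
  "grover G e f =
     (if e = prod.swap f then 2 / real (out_degree (with_proj G) (snd f)) - 1
      else if snd f = fst e then 2 / real (out_degree (with_proj G) (snd f))
      else 0)"

definition grover_periodic :: "'v pair_pre_digraph \<Rightarrow> bool" where
  "grover_periodic G \<longleftrightarrow>
     (\<exists>k>0. \<forall>e\<in>parcs G. \<forall>f\<in>parcs G. idx_mat_pow (parcs G) (grover G) k e f = idx_mat_one e f)"

definition hamming_verts :: "nat \<Rightarrow> 'a set \<Rightarrow> (nat \<Rightarrow> 'a) set" where
  "hamming_verts d F = {1..d} \<rightarrow>\<^sub>E F"

definition hamming_graph :: "nat \<Rightarrow> 'a set \<Rightarrow> (nat \<Rightarrow> 'a) pair_pre_digraph" where
  "hamming_graph d F =
     \<lparr> pverts = hamming_verts d F,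
       parcs = {(x, y). x \<in> hamming_verts d F \<and> y \<in> hamming_verts d F \<and>
                        card {i \<in> {1..d}. x i \<noteq> y i} = 1} \<rparr>"

lemma pair_graph_hamming_graph:
  assumes "finite F"
  shows "pair_graph (hamming_graph d F)"
proof -
  have fin: "finite (hamming_verts d F)"
    unfolding hamming_verts_def using assms by (intro finite_PiE) auto
  have "parcs (hamming_graph d F) \<subseteq> hamming_verts d F \<times> hamming_verts d F"
    by (auto simp: hamming_graph_def)
  then have fina: "finite (parcs (hamming_graph d F))"
    using fin by (meson finite_SigmaI finite_subset)
  have "{i \<in> {1..d}. x i \<noteq> y i} = {i \<in> {1..d}. y i \<noteq> x i}" for x y :: "nat \<Rightarrow> 'a"
    by auto
  then have "sym (parcs (hamming_graph d F))"
    unfolding sym_def hamming_graph_def by (metis (no_types, lifting) case_prodD case_prodI mem_Collect_eq pair_pre_digraph.select_convs(2))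
  then show ?thesis
    using fin fina
    by unfold_locales (auto simp: hamming_graph_def symmetric_def)
qed

end

theory Submission
  imports Defs "HOL-Computational_Algebra.Polynomial"
begin

text \<open>
  Let \<open>U\<close> be the Grover matrix of a \<open>k\<close>-regular graph. For a function \<open>g\<close> on the vertices put
  \<open>g\<^sub>h e = g (snd e)\<close> and \<open>g\<^sub>t e = g (fst e)\<close>. Then \<open>U g\<^sub>h = g\<^sub>t\<close>, and \<open>U g\<^sub>t = x g\<^sub>t - g\<^sub>h\<close> if \<open>g\<close> is
  an eigenfunction of the adjacency matrix with eigenvalue \<open>k x / 2\<close>. Hence
  \<open>U\<^sup>n g\<^sub>h = p\<^sub>n(x) g\<^sub>t - p\<^sub>n\<^sub>-\<^sub>1(x) g\<^sub>h\<close> with rescaled Chebyshev polynomials \<open>p\<^sub>n\<close> of the second kind,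
  which are monic with integer coefficients.

  For the Hamming graph, \<open>g = 1\<^sub>a - 1\<^sub>b\<close> in the first coordinate has \<open>x = 2 - 2 q / (d (q - 1))\<close>.
  Evaluating \<open>U\<^sup>n g\<^sub>h = g\<^sub>h\<close> on an arc along which the first coordinate changes from \<open>a\<close> to \<open>b\<close> makes
  the rational number \<open>x\<close> a root of the monic integer polynomial \<open>p\<^sub>n + p\<^sub>n\<^sub>-\<^sub>1 + 1\<close>, hence an integer;
  so \<open>d (q - 1)\<close> divides \<open>2 q\<close>, which leaves the five listed pairs.

  Conversely, for these pairs every \<open>x\<close> lies in \<open>{-2, ..., 2}\<close>, and \<open>U\<^sup>1\<^sup>2 = 1\<close>: since \<open>U\<close> is an
  isometry it suffices that \<open>U\<^sup>1\<^sup>2 - 1\<close> is nilpotent, which is checked on the functions \<open>g\<^sub>h\<close> first.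
\<close>

section \<open>Chebyshev polynomials as monic integer polynomials\<close>

text \<open>The index is shifted by one against the degree: \<open>vieta_poly (Suc n)\<close> is
  \<open>U_n(x/2)\<close>, with \<open>U_n\<close> the Chebyshev polynomial of the second
  kind.\<close>

fun vieta_poly :: "nat \<Rightarrow> real poly" where
  "vieta_poly 0 = 0"
| "vieta_poly (Suc 0) = 1"
| "vieta_poly (Suc (Suc n)) = pCons 0 (vieta_poly (Suc n)) - vieta_poly n"

lemma coeff_vieta_poly_eq_0: "n \<le> i \<Longrightarrow> coeff (vieta_poly n) i = 0"
  by (induction n arbitrary: i rule: vieta_poly.induct)
     (auto simp: coeff_pCons split: nat.split)

lemma coeff_vieta_poly_Suc: "coeff (vieta_poly (Suc n)) n = 1"
  by (induction n) (simp_all add: coeff_vieta_poly_eq_0)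

lemma coeff_vieta_poly_Ints: "coeff (vieta_poly n) i \<in> \<int>"
  by (induction n arbitrary: i rule: vieta_poly.induct)
     (auto simp: coeff_pCons split: nat.split)

lemma vieta_poly_sum_root_Ints:
  fixes x :: real
  assumes "x \<in> \<rat>" and root: "poly (vieta_poly (Suc n)) x + poly (vieta_poly n) x + 1 = 0"
  shows "x \<in> \<int>"
\<comment> \<open>For \<open>n = 0\<close> the sum is the constant 2, which has no root. For
  \<open>n > 0\<close> neither \<open>vieta_poly n\<close> nor the added 1 reaches degree
  \<open>n\<close>, so the sum is monic.\<close>
proof (cases "n = 0")
  case False
  define p where "p = vieta_poly (Suc n) + vieta_poly n + 1"
  have top: "coeff p n = 1"
    using False by (simp add: p_def coeff_vieta_poly_Suc coeff_vieta_poly_eq_0)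
  have "coeff p i = 0" if "i > n" for i
    using that by (simp add: p_def coeff_vieta_poly_eq_0 del: vieta_poly.simps)
  then have "degree p = n"
    using top by (intro antisym degree_le le_degree) auto
  then have "algebraic_int x"
    using top root
    by (intro algebraic_int.intros[of p])
       (auto simp: p_def coeff_vieta_poly_Ints simp del: vieta_poly.simps)
  then show ?thesis
    using assms(1) by (rule rational_algebraic_int_is_int)
qed (use root in simp)

section \<open>Linear isometries\<close>

lemma funpow_fixed_dvd:
  assumes "m dvd n" and "(f ^^ m) x = x"
  shows "(f ^^ n) x = x"
proof -
  obtain j where "n = m * j" using assms(1) by blast
  moreover have "(f ^^ (m * j)) x = x"
    by (induction j) (simp_all add: funpow_add assms(2))
  ultimately show ?thesis by simp
qed

text \<open>Linearity through pointwise combinations of two functions. The explicit factors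
  \<open>1\<close> and \<open>(-1)\<close> further on make terms match this pattern.\<close>

definition lincomb_preserving :: "(('i \<Rightarrow> real) \<Rightarrow> 'i \<Rightarrow> real) \<Rightarrow> bool" where
  "lincomb_preserving T \<longleftrightarrow>
     (\<forall>a b \<phi> \<psi>. T (\<lambda>e. a * \<phi> e + b * \<psi> e) = (\<lambda>e. a * T \<phi> e + b * T \<psi> e))"

lemma lincomb_preservingD:
  "lincomb_preserving T \<Longrightarrow> T (\<lambda>e. a * \<phi> e + b * \<psi> e) = (\<lambda>e. a * T \<phi> e + b * T \<psi> e)"
  by (simp add: lincomb_preserving_def)

lemma lincomb_preserving_funpow: "lincomb_preserving T \<Longrightarrow> lincomb_preserving (T ^^ n)"
  by (induction n) (simp_all add: lincomb_preserving_def)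

text \<open>The orbit \<open>T\<^sup>n \<psi> = \<psi> + n (T \<psi> - \<psi>)\<close> can only stay bounded if \<open>T \<psi> = \<psi>\<close>.\<close>

lemma unipotent_isometry_fixes:
  fixes T :: "('i \<Rightarrow> real) \<Rightarrow> 'i \<Rightarrow> real"
  assumes "finite A" and lin: "lincomb_preserving T"
    and iso: "\<And>\<phi>. (\<Sum>e\<in>A. (T \<phi> e)\<^sup>2) = (\<Sum>e\<in>A. (\<phi> e)\<^sup>2)"
    and uni: "T (T \<psi>) = (\<lambda>e. 2 * T \<psi> e - \<psi> e)"
    and "e \<in> A"
  shows "T \<psi> e = \<psi> e"
proof -
  define c where "c = T \<psi> e - \<psi> e"
  define B where "B = (\<Sum>e\<in>A. (\<psi> e)\<^sup>2)"
  have orbit: "(T ^^ n) \<psi> = (\<lambda>e. (1 - real n) * \<psi> e + real n * T \<psi> e)" for n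
  proof (induction n)
    case (Suc n)
    have "(T ^^ Suc n) \<psi> = T (\<lambda>e. (1 - real n) * \<psi> e + real n * T \<psi> e)"
      by (simp add: Suc)
    also have "\<dots> = (\<lambda>e. (1 - real n) * T \<psi> e + real n * T (T \<psi>) e)"
      by (rule lincomb_preservingD[OF lin])
    finally show ?case
      by (simp add: uni algebra_simps)
  qed simp
  have norm: "(\<Sum>e\<in>A. ((T ^^ n) \<psi> e)\<^sup>2) = B" for n
    by (induction n) (simp_all add: B_def iso)
  have bound: "(\<psi> e + real n * c)\<^sup>2 \<le> B" for n
  proof -
    have "((T ^^ n) \<psi> e)\<^sup>2 \<le> (\<Sum>e\<in>A. ((T ^^ n) \<psi> e)\<^sup>2)"
      using assms(1) \<open>e \<in> A\<close> by (intro member_le_sum) auto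
    then show ?thesis
      unfolding norm by (simp add: orbit c_def algebra_simps)
  qed
  have bound': "real n * \<bar>c\<bar> \<le> sqrt B + \<bar>\<psi> e\<bar>" for n
  proof -
    have "\<bar>\<psi> e + real n * c\<bar> \<le> sqrt B"
      using bound[of n] by (simp add: real_le_rsqrt)
    moreover have "\<bar>real n * c\<bar> \<le> \<bar>\<psi> e + real n * c\<bar> + \<bar>\<psi> e\<bar>"
      by linarith
    ultimately show ?thesis
      by (simp add: abs_mult)
  qed
  have "c = 0"
  proof (rule ccontr)
    assume "c \<noteq> 0"
    then obtain n where "real n * \<bar>c\<bar> > sqrt B + \<bar>\<psi> e\<bar>"
      using reals_Archimedean3[of "\<bar>c\<bar>"] by auto
    with bound'[of n] show False by simp
  qed
  then show ?thesis by (simp add: c_def)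
qed

section \<open>The Grover walk on a regular graph\<close>

locale regular_pair_graph = pair_graph G for G :: "'v pair_pre_digraph" +
  fixes k :: nat
  assumes degree_pos: "k > 0"
    and regular: "\<And>v. v \<in> pverts G \<Longrightarrow> out_degree (with_proj G) v = k"
begin

text \<open>The value 0 off the arcs lets identities be equations between total functions;
  \<open>arc_supported\<close> marks the functions on which even the zeroth iterate respects this
  convention.\<close>

definition walk :: "('v \<times> 'v \<Rightarrow> real) \<Rightarrow> 'v \<times> 'v \<Rightarrow> real" where
  "walk \<psi> e = (if e \<in> parcs G then \<Sum>f\<in>parcs G. grover G e f * \<psi> f else 0)"

definition arc_supported :: "('v \<times> 'v \<Rightarrow> real) \<Rightarrow> bool" where
  "arc_supported \<psi> \<longleftrightarrow> (\<forall>e. e \<notin> parcs G \<longrightarrow> \<psi> e = 0)"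

text \<open>The sum over arcs entering \<open>v\<close>, indexed by their reversals, so that the
  out-degree counts its terms.\<close>

definition in_sum :: "('v \<times> 'v \<Rightarrow> real) \<Rightarrow> 'v \<Rightarrow> real" where
  "in_sum \<psi> v = (\<Sum>f\<in>{f \<in> parcs G. fst f = v}. \<psi> (prod.swap f))"

definition lift_head :: "('v \<Rightarrow> real) \<Rightarrow> 'v \<times> 'v \<Rightarrow> real" where
  "lift_head g e = (if e \<in> parcs G then g (snd e) else 0)"

definition lift_tail :: "('v \<Rightarrow> real) \<Rightarrow> 'v \<times> 'v \<Rightarrow> real" where
  "lift_tail g e = (if e \<in> parcs G then g (fst e) else 0)"

definition eigenfun :: "real \<Rightarrow> ('v \<Rightarrow> real) \<Rightarrow> bool" where
  "eigenfun \<mu> g \<longleftrightarrow> (\<forall>v\<in>pverts G. (\<Sum>f\<in>{f \<in> parcs G. fst f = v}. g (snd f)) = \<mu> * g v)"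

lemma swap_arc [simp]: "prod.swap e \<in> parcs G \<longleftrightarrow> e \<in> parcs G"
  using pair_sym_arcs by (cases e) (auto simp: symmetric_def dest: symD)

lemma arc_sym: "(u, v) \<in> parcs G \<Longrightarrow> (v, u) \<in> parcs G"
  using swap_arc[of "(u, v)"] by simp

lemma swap_arcs_image: "prod.swap ` parcs G = parcs G"
  by (metis swap_arc image_eqI subsetI subset_antisym image_subset_iff swap_swap)

lemma sum_swap_arcs: "(\<Sum>e\<in>parcs G. h (prod.swap e)) = (\<Sum>e\<in>parcs G. h e)"
  by (subst (2) swap_arcs_image[symmetric], subst sum.reindex) auto

lemma card_out_arcs: "v \<in> pverts G \<Longrightarrow> card {f \<in> parcs G. fst f = v} = k"
  using regular[of v] by (simp add: out_degree_def out_arcs_def)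

lemma in_sum_alt: "in_sum \<psi> v = (\<Sum>f\<in>parcs G. if snd f = v then \<psi> f else 0)"
proof -
  have "in_sum \<psi> v = (\<Sum>f\<in>parcs G. if snd (prod.swap f) = v then \<psi> (prod.swap f) else 0)"
    by (simp add: in_sum_def sum.inter_filter[OF pair_finite_arcs])
  then show ?thesis
    by (simp only: sum_swap_arcs[of "\<lambda>f. if snd f = v then \<psi> f else 0"])
qed

text \<open>Row \<open>e\<close> of the Grover matrix has \<open>2/k\<close> at every arc ending in
  \<open>fst e\<close>, with an additional \<open>-1\<close> at the reversal of
  \<open>e\<close>.\<close>

lemma walk_eq:
  assumes "e \<in> parcs G"
  shows "walk \<psi> e = 2 / k * in_sum \<psi> (fst e) - \<psi> (prod.swap e)"
proof -
  have "walk \<psi> e = (\<Sum>f\<in>parcs G. 2 / k * (if snd f = fst e then \<psi> f else 0)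
                      - (if f = prod.swap e then \<psi> f else 0))"
    unfolding walk_def using assms
    by (cases e) (auto simp: grover_def regular in_arcsD1 algebra_simps intro!: sum.cong)
  also have "\<dots> = 2 / k * in_sum \<psi> (fst e) - \<psi> (prod.swap e)"
    using assms by (simp add: sum_subtractf in_sum_alt sum_distrib_left sum_divide_distrib)
  finally show ?thesis .
qed

lemma walk_outside [simp]: "e \<notin> parcs G \<Longrightarrow> walk \<psi> e = 0"
  by (simp add: walk_def)

lemma lincomb_preserving_walk: "lincomb_preserving walk"
  by (auto simp: lincomb_preserving_def walk_def fun_eq_iff algebra_simps sum.distrib
      sum_distrib_left)

text \<open>Up to arc reversal, the walk acts at each vertex as the reflection
  \<open>(2/k) J - 1\<close>, with \<open>J\<close> the all-ones matrix.\<close>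

lemma walk_isometry: "(\<Sum>e\<in>parcs G. (walk \<psi> e)\<^sup>2) = (\<Sum>e\<in>parcs G. (\<psi> e)\<^sup>2)"
proof -
  define c where "c = 2 / real k"
  have kc: "real k * c\<^sup>2 = 2 * c"
    using degree_pos by (simp add: c_def power2_eq_square)
  \<comment> \<open>The excess of \<open>(walk \<psi> e)^2\<close> over the square of
    \<open>\<psi>\<close> at the reversed arc; it cancels in the sum over the arcs leaving one
    vertex.\<close>
  define h where "h e = (c * in_sum \<psi> (fst e))\<^sup>2 - 2 * c * in_sum \<psi> (fst e) * \<psi> (prod.swap e)" for e
  have zero: "(\<Sum>e\<in>{e \<in> parcs G. fst e = v}. h e) = 0" if "v \<in> pverts G" for v
  proof -
    have "(\<Sum>e\<in>{e \<in> parcs G. fst e = v}. h e)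
        = (\<Sum>e\<in>{e \<in> parcs G. fst e = v}. (c * in_sum \<psi> v)\<^sup>2 - 2 * c * in_sum \<psi> v * \<psi> (prod.swap e))"
      by (intro sum.cong) (auto simp: h_def)
    also have "\<dots> = k * (c * in_sum \<psi> v)\<^sup>2 - 2 * c * in_sum \<psi> v * in_sum \<psi> v"
      using that by (simp add: sum_subtractf card_out_arcs sum_distrib_left[symmetric] in_sum_def)
    also have "\<dots> = (real k * c\<^sup>2 - 2 * c) * (in_sum \<psi> v)\<^sup>2"
      by (simp add: algebra_simps power2_eq_square)
    finally show ?thesis by (simp add: kc)
  qed
  have "(\<Sum>e\<in>parcs G. (walk \<psi> e)\<^sup>2) = (\<Sum>e\<in>parcs G. h e + (\<psi> (prod.swap e))\<^sup>2)"
    by (intro sum.cong) (auto simp: walk_eq h_def c_def power2_diff)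
  also have "\<dots> = (\<Sum>e\<in>parcs G. h e) + (\<Sum>e\<in>parcs G. (\<psi> e)\<^sup>2)"
    by (simp add: sum.distrib sum_swap_arcs[of "\<lambda>e. (\<psi> e)\<^sup>2"])
  also have "(\<Sum>e\<in>parcs G. h e) = (\<Sum>v\<in>pverts G. \<Sum>e\<in>{e \<in> parcs G. fst e = v}. h e)"
    by (intro sum.group[symmetric]) (auto simp: pair_finite_arcs pair_finite_verts in_arcsD1)
  finally show ?thesis by (simp add: zero)
qed

lemma walk_funpow_isometry: "(\<Sum>e\<in>parcs G. ((walk ^^ n) \<psi> e)\<^sup>2) = (\<Sum>e\<in>parcs G. (\<psi> e)\<^sup>2)"
  by (induction n) (simp_all add: walk_isometry)

lemma arc_supported_walk_funpow: "arc_supported \<psi> \<Longrightarrow> arc_supported ((walk ^^ n) \<psi>)"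
  by (cases n) (auto simp: arc_supported_def)

lemma arc_supportedD: "arc_supported \<psi> \<Longrightarrow> e \<notin> parcs G \<Longrightarrow> \<psi> e = 0"
  unfolding arc_supported_def by blast

lemma arc_supported_lift [simp]: "arc_supported (lift_head g)" "arc_supported (lift_tail g)"
  by (simp_all add: arc_supported_def lift_head_def lift_tail_def)

text \<open>The isometry argument for \<open>T = walk ^^ n\<close>: the hypothesis says that
  \<open>(T - 1)^2\<close> kills \<open>\<psi>\<close>.\<close>

lemma walk_funpow_unipotent:
  assumes "arc_supported \<psi>"
    and "(walk ^^ n) ((walk ^^ n) \<psi>) = (\<lambda>e. 2 * (walk ^^ n) \<psi> e - \<psi> e)"
  shows "(walk ^^ n) \<psi> = \<psi>"
proof
  fix e
  show "(walk ^^ n) \<psi> e = \<psi> e"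
  proof (cases "e \<in> parcs G")
    case True
    then show ?thesis
      using unipotent_isometry_fixes[OF pair_finite_arcs
          lincomb_preserving_funpow[OF lincomb_preserving_walk] walk_funpow_isometry assms(2)]
      by simp
  next
    case False
    then show ?thesis
      using assms(1) arc_supported_walk_funpow[OF assms(1)] by (simp add: arc_supportedD)
  qed
qed

lemma idx_mat_pow_walk:
  assumes "arc_supported \<psi>" and "e \<in> parcs G"
  shows "(\<Sum>f\<in>parcs G. idx_mat_pow (parcs G) (grover G) n e f * \<psi> f) = (walk ^^ n) \<psi> e"
  using assms(2)
proof (induction n arbitrary: e)
  case 0
  then show ?case
    by (simp add: idx_mat_one_def pair_finite_arcs if_distrib[of "\<lambda>x. x * _"] cong: if_cong)
next
  case (Suc n)
  have "(\<Sum>f\<in>parcs G. idx_mat_pow (parcs G) (grover G) (Suc n) e f * \<psi> f)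
      = (\<Sum>g\<in>parcs G. grover G e g * (\<Sum>f\<in>parcs G. idx_mat_pow (parcs G) (grover G) n g f * \<psi> f))"
    by (simp add: idx_mat_mult_def sum_distrib_right sum_distrib_left mult.assoc)
       (rule sum.swap)
  also have "\<dots> = (\<Sum>g\<in>parcs G. grover G e g * (walk ^^ n) \<psi> g)"
    by (intro sum.cong) (auto simp: Suc.IH)
  also have "\<dots> = (walk ^^ Suc n) \<psi> e"
    using Suc.prems by (simp add: walk_def)
  finally show ?case .
qed

lemma grover_periodic_iff:
  "grover_periodic G \<longleftrightarrow> (\<exists>n>0. \<forall>\<psi>. arc_supported \<psi> \<longrightarrow> (walk ^^ n) \<psi> = \<psi>)"
proof -
  have "(\<forall>e\<in>parcs G. \<forall>f\<in>parcs G. idx_mat_pow (parcs G) (grover G) n e f = idx_mat_one e f)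
    \<longleftrightarrow> (\<forall>\<psi>. arc_supported \<psi> \<longrightarrow> (walk ^^ n) \<psi> = \<psi>)" (is "?L \<longleftrightarrow> ?R") for n
  proof
    assume L: ?L
    show ?R
    proof (intro allI impI ext)
      fix \<psi> e assume \<psi>: "arc_supported \<psi>"
      show "(walk ^^ n) \<psi> e = \<psi> e"
      proof (cases "e \<in> parcs G")
        case True
        have "(walk ^^ n) \<psi> e = (\<Sum>f\<in>parcs G. idx_mat_pow (parcs G) (grover G) 0 e f * \<psi> f)"
          using L True by (simp add: idx_mat_pow_walk[OF \<psi> True, symmetric])
        also have "\<dots> = \<psi> e"
          by (subst idx_mat_pow_walk[OF \<psi> True]) simp
        finally show ?thesis .
      next
        case False
        then show ?thesis
          using \<psi> arc_supported_walk_funpow[OF \<psi>] by (simp add: arc_supportedD)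
      qed
    qed
  next
    assume R: ?R
    show ?L
    proof (intro ballI)
      fix e f assume e: "e \<in> parcs G" and f: "f \<in> parcs G"
      \<comment> \<open>The indicator of the arc \<open>f\<close>, which extracts column
        \<open>f\<close> of the matrix power.\<close>
      define \<psi> where "\<psi> g = idx_mat_one g f" for g
      have \<psi>: "arc_supported \<psi>"
        using f by (auto simp: arc_supported_def \<psi>_def idx_mat_one_def)
      have "idx_mat_pow (parcs G) (grover G) n e f
          = (\<Sum>g\<in>parcs G. idx_mat_pow (parcs G) (grover G) n e g * \<psi> g)"
        using f by (simp add: \<psi>_def idx_mat_one_def pair_finite_arcs
            if_distrib[of "\<lambda>x. _ * x"] cong: if_cong)
      also have "\<dots> = \<psi> e"
        using R \<psi> by (simp add: idx_mat_pow_walk[OF \<psi> e])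
      finally show "idx_mat_pow (parcs G) (grover G) n e f = idx_mat_one e f"
        by (simp add: \<psi>_def)
    qed
  qed
  then show ?thesis by (simp add: grover_periodic_def)
qed

section \<open>Functions lifted from the vertices\<close>

lemma walk_lift_head: "walk (lift_head g) = lift_tail g"
proof
  fix e
  show "walk (lift_head g) e = lift_tail g e"
  proof (cases "e \<in> parcs G")
    case True
    have "in_sum (lift_head g) (fst e) = (\<Sum>f\<in>{f \<in> parcs G. fst f = fst e}. g (fst e))"
      unfolding in_sum_def by (intro sum.cong) (auto simp: lift_head_def dest: arc_sym)
    also have "\<dots> = k * g (fst e)"
      using True by (simp add: card_out_arcs arc_fst_in_verts)
    finally show ?thesis
      using True degree_pos by (simp add: walk_eq) (simp add: lift_head_def lift_tail_def)
  qed (simp add: lift_tail_def)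
qed

text \<open>The values of \<open>lift_tail g\<close> on the arcs entering a vertex are those of
  \<open>g\<close> at its neighbours, so \<open>in_sum\<close> becomes the adjacency
  operator.\<close>

lemma walk_lift_tail:
  fixes x :: real
  assumes "eigenfun (k * x / 2) g"
  shows "walk (lift_tail g) = (\<lambda>e. x * lift_tail g e + (-1) * lift_head g e)"
proof
  fix e
  show "walk (lift_tail g) e = x * lift_tail g e + (-1) * lift_head g e"
  proof (cases "e \<in> parcs G")
    case True
    have "in_sum (lift_tail g) (fst e) = (\<Sum>f\<in>{f \<in> parcs G. fst f = fst e}. g (snd f))"
      unfolding in_sum_def by (intro sum.cong) (auto simp: lift_tail_def dest: arc_sym)
    also have "\<dots> = k * x / 2 * g (fst e)"
      using True assms by (simp add: eigenfun_def arc_fst_in_verts)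
    finally show ?thesis
      using True degree_pos by (simp add: walk_eq field_simps) (simp add: lift_head_def lift_tail_def)
  qed (simp add: lift_tail_def lift_head_def)
qed

text \<open>On the span of the two lifts the walk satisfies \<open>U^2 - x U + 1 = 0\<close>, the
  recursion of \<open>vieta_poly\<close>. Exponent 0 is left out because it would call for index
  -1.\<close>

lemma walk_funpow_lift_head:
  fixes x :: real
  assumes "eigenfun (k * x / 2) g"
  shows "(walk ^^ Suc n) (lift_head g)
       = (\<lambda>e. poly (vieta_poly (Suc n)) x * lift_tail g e + (- poly (vieta_poly n) x) * lift_head g e)"
proof (induction n)
  case 0
  then show ?case by (simp add: walk_lift_head)
next
  case (Suc n)
  have "(walk ^^ Suc (Suc n)) (lift_head g) = walk ((walk ^^ Suc n) (lift_head g))"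
    by simp
  also have "\<dots> = (\<lambda>e. poly (vieta_poly (Suc n)) x * walk (lift_tail g) e
                     + (- poly (vieta_poly n) x) * walk (lift_head g) e)"
    unfolding Suc by (rule lincomb_preservingD[OF lincomb_preserving_walk])
  finally show ?case
    by (simp add: walk_lift_tail[OF assms] walk_lift_head algebra_simps)
qed

text \<open>With \<open>x = 2 cos t\<close> the walk has eigenvalues \<open>exp(it)\<close> and
  \<open>exp(-it)\<close> here. For \<open>x = -2, -1, 0, 1, 2\<close> their orders are 2, 3, 4, 6,
  1, with least common multiple 12.\<close>

lemma lift_head_period:
  fixes x :: real
  assumes eig: "eigenfun (k * x / 2) g" and "x \<in> {-2, -1, 0, 1, 2}"
  shows "(walk ^^ 12) (lift_head g) = lift_head g"
proof -
  note orbit = walk_funpow_lift_head[OF eig]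
  consider "x = -2" | "x = -1" | "x = 0" | "x = 1" | "x = 2"
    using assms(2) by auto
  then obtain m where "m dvd 12" "(walk ^^ m) (lift_head g) = lift_head g"
  proof cases
    case 1
    \<comment> \<open>For \<open>x = -2\<close>, and likewise for \<open>x = 2\<close>, the two
      eigenvalues coincide. The recursion then gives only unipotence, and the isometry property must
      exclude a Jordan block.\<close>
    have "(walk ^^ 2) ((walk ^^ 2) (lift_head g)) = (walk ^^ Suc 3) (lift_head g)"
      by (simp add: numeral_eq_Suc)
    also have "\<dots> = (\<lambda>e. 2 * (walk ^^ Suc 1) (lift_head g) e - lift_head g e)"
      unfolding orbit using 1 by (simp add: numeral_eq_Suc algebra_simps)
    finally have "(walk ^^ 2) (lift_head g) = lift_head g"
      by (intro walk_funpow_unipotent) (simp_all add: numeral_2_eq_2)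
    then show thesis by (intro that[of 2]) simp_all
  next
    case 2
    have "(walk ^^ Suc 2) (lift_head g) = lift_head g"
      unfolding orbit using 2 by (simp add: numeral_eq_Suc)
    then show thesis by (intro that[of "Suc 2"]) simp_all
  next
    case 3
    have "(walk ^^ Suc 3) (lift_head g) = lift_head g"
      unfolding orbit using 3 by (simp add: numeral_eq_Suc)
    then show thesis by (intro that[of "Suc 3"]) simp_all
  next
    case 4
    have "(walk ^^ Suc 5) (lift_head g) = lift_head g"
      unfolding orbit using 4 by (simp add: numeral_eq_Suc)
    then show thesis by (intro that[of "Suc 5"]) simp_all
  next
    case 5
    have "(walk ^^ 1) ((walk ^^ 1) (lift_head g)) = (walk ^^ Suc 1) (lift_head g)"
      by simp
    also have "\<dots> = (\<lambda>e. 2 * (walk ^^ Suc 0) (lift_head g) e - lift_head g e)"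
      unfolding orbit using 5 by (simp add: algebra_simps)
    finally have "(walk ^^ 1) (lift_head g) = lift_head g"
      by (intro walk_funpow_unipotent) simp_all
    then show thesis by (intro that[of 1]) simp_all
  qed
  then show ?thesis by (rule funpow_fixed_dvd)
qed

text \<open>The image of \<open>U\<^sup>2 - 1\<close> lies in the span of the functions \<open>lift_head g\<close> and their images
  under \<open>U\<close>, so periodicity on those functions makes \<open>U\<^sup>n - 1\<close> nilpotent.\<close>

lemma walk_funpow_eq_id:
  assumes lift: "\<And>g. (walk ^^ n) (lift_head g) = lift_head g" and "even n"
    and "arc_supported \<psi>"
  shows "(walk ^^ n) \<psi> = \<psi>"
proof (rule walk_funpow_unipotent)
  note lin = lincomb_preservingD[OF lincomb_preserving_walk]
  note linn = lincomb_preservingD[OF lincomb_preserving_funpow[OF lincomb_preserving_walk]]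
  define S where "S \<phi> = \<phi> \<circ> prod.swap" for \<phi> :: "'v \<times> 'v \<Rightarrow> real"
  define g where "g v = 2 / k * in_sum \<psi> v" for v
  define h where "h v = 2 / k * in_sum (S \<psi>) v" for v
  \<comment> \<open>This is \<open>U^2 \<psi> - \<psi>\<close>: apply
    \<open>U \<phi> = lift_tail (...) - S \<phi>\<close> twice, use that \<open>S\<close> is an
    involution, and write each \<open>lift_tail\<close> as \<open>U\<close> applied to a
    \<open>lift_head\<close>.\<close>
  define \<chi> where "\<chi> e = 1 * (walk ^^ 2) (lift_head g) e + (-1) * walk (lift_head h) e" for e
  have step: "walk \<phi> = (\<lambda>e. 1 * lift_tail (\<lambda>v. 2 / k * in_sum \<phi> v) e + (-1) * S \<phi> e)"
    if "arc_supported \<phi>" for \<phi>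
  proof
    fix e
    show "walk \<phi> e = 1 * lift_tail (\<lambda>v. 2 / k * in_sum \<phi> v) e + (-1) * S \<phi> e"
      using that by (cases "e \<in> parcs G") (simp_all add: walk_eq lift_tail_def S_def arc_supportedD)
  qed
  have S: "arc_supported (S \<psi>)"
    using \<open>arc_supported \<psi>\<close> by (auto simp: arc_supported_def S_def dest: arc_sym)
  have "(walk ^^ 2) \<psi> = walk (walk \<psi>)"
    by (simp add: numeral_2_eq_2)
  also have "\<dots> = walk (\<lambda>e. 1 * lift_tail g e + (-1) * S \<psi> e)"
    using step[OF \<open>arc_supported \<psi>\<close>] by (simp add: g_def[abs_def])
  also have "\<dots> = (\<lambda>e. 1 * walk (lift_tail g) e + (-1) * walk (S \<psi>) e)"
    by (rule lin)
  also have "walk (S \<psi>) = (\<lambda>e. 1 * lift_tail h e + (-1) * \<psi> e)"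
    using step[OF S] by (simp add: h_def[abs_def]) (simp add: S_def o_def)
  also have "(\<lambda>e. 1 * walk (lift_tail g) e + (-1) * (1 * lift_tail h e + (-1) * \<psi> e))
           = (\<lambda>e. 1 * \<psi> e + 1 * \<chi> e)"
    by (simp add: \<chi>_def numeral_2_eq_2 walk_lift_head algebra_simps)
  finally have sq: "(walk ^^ 2) \<psi> = (\<lambda>e. 1 * \<psi> e + 1 * \<chi> e)" .
  have comm: "(walk ^^ n) ((walk ^^ m) \<phi>) = (walk ^^ m) ((walk ^^ n) \<phi>)" for m \<phi>
    by (metis add.commute comp_apply funpow_add)
  have \<chi>: "(walk ^^ n) \<chi> = \<chi>"
    unfolding \<chi>_def linn comm[of 2] lift using comm[of 1 "lift_head h"] by (simp add: lift)
  \<comment> \<open>As \<open>U^n\<close> fixes \<open>\<chi>\<close>, the difference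
    \<open>\<eta> = (U^n - 1) \<psi>\<close> is fixed by \<open>U^2\<close>, hence by
    \<open>U^n\<close> because \<open>n\<close> is even; so \<open>(U^n - 1)^2\<close> kills
    \<open>\<psi>\<close>.\<close>
  define \<eta> where "\<eta> e = 1 * (walk ^^ n) \<psi> e + (-1) * \<psi> e" for e
  have "(walk ^^ 2) \<eta> = (\<lambda>e. 1 * (walk ^^ n) ((walk ^^ 2) \<psi>) e + (-1) * (walk ^^ 2) \<psi> e)"
    unfolding \<eta>_def linn comm[of 2] ..
  also have "\<dots> = \<eta>"
    unfolding sq linn \<chi> by (simp add: \<eta>_def[abs_def])
  finally have "(walk ^^ n) \<eta> = \<eta>"
    by (rule funpow_fixed_dvd[OF \<open>even n\<close>])
  then have fixed: "(\<lambda>e. 1 * (walk ^^ n) ((walk ^^ n) \<psi>) e + (-1) * (walk ^^ n) \<psi> e) = \<eta>"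
    unfolding \<eta>_def linn .
  show "(walk ^^ n) ((walk ^^ n) \<psi>) = (\<lambda>e. 2 * (walk ^^ n) \<psi> e - \<psi> e)"
  proof
    fix e
    show "(walk ^^ n) ((walk ^^ n) \<psi>) e = 2 * (walk ^^ n) \<psi> e - \<psi> e"
      using fun_cong[OF fixed, of e] unfolding \<eta>_def by linarith
  qed
qed fact

lemma lift_head_add: "lift_head (\<lambda>v. g v + h v) = (\<lambda>e. 1 * lift_head g e + 1 * lift_head h e)"
  by (simp add: lift_head_def fun_eq_iff)

end

section \<open>Spectral decomposition of the Hamming graph\<close>

text \<open>For finite nonempty \<open>F\<close>, the projection that averages out coordinate
  \<open>i\<close>. The adjacency operator will be the sum of
  \<open>card F * coord_avg F i - 1\<close> over \<open>i\<close>.\<close>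

definition coord_avg :: "'a set \<Rightarrow> 'i \<Rightarrow> (('i \<Rightarrow> 'a) \<Rightarrow> real) \<Rightarrow> ('i \<Rightarrow> 'a) \<Rightarrow> real" where
  "coord_avg F i g x = (\<Sum>a\<in>F. g (x(i := a))) / card F"

lemma coord_avg_diff:
  "coord_avg F i (\<lambda>x. g x - h x) = (\<lambda>x. coord_avg F i g x - coord_avg F i h x)"
  by (simp add: coord_avg_def fun_eq_iff sum_subtractf diff_divide_distrib)

lemma coord_avg_zero [simp]: "coord_avg F i (\<lambda>x. 0) = (\<lambda>x. 0)"
  by (simp add: coord_avg_def fun_eq_iff)

lemma coord_avg_idem:
  assumes "finite F" "F \<noteq> {}"
  shows "coord_avg F i (coord_avg F i g) = coord_avg F i g"
  using assms by (simp add: coord_avg_def fun_eq_iff)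

lemma coord_avg_commute:
  "coord_avg F i (coord_avg F j g) = coord_avg F j (coord_avg F i g)"
proof (cases "i = j")
  case False
  have "(\<Sum>a\<in>F. \<Sum>b\<in>F. g (x(i := a, j := b))) = (\<Sum>b\<in>F. \<Sum>a\<in>F. g (x(j := b, i := a)))" for x
    by (subst sum.swap) (simp add: fun_upd_twist[OF False])
  then show ?thesis
    by (simp add: coord_avg_def fun_eq_iff sum_divide_distrib[symmetric])
qed simp

text \<open>Decompose \<open>g = E\<^sub>i g + (g - E\<^sub>i g)\<close> successively along each of the commuting
  projections \<open>E\<^sub>i = coord_avg F i\<close>.\<close>

lemma coord_avg_decomposition:
  fixes P :: "(('i \<Rightarrow> 'a) \<Rightarrow> real) \<Rightarrow> bool"
  assumes F: "finite F" "F \<noteq> {}" and "finite I"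
    and add: "\<And>g h. P g \<Longrightarrow> P h \<Longrightarrow> P (\<lambda>x. g x + h x)"
    and eig: "\<And>g. \<forall>i\<in>I. coord_avg F i g = g \<or> coord_avg F i g = (\<lambda>x. 0) \<Longrightarrow> P g"
  shows "P g"
proof -
  \<comment> \<open>\<open>J\<close> collects the coordinates along which \<open>g\<close> has not
    been split yet.\<close>
  have "P g" if "J \<subseteq> I" "\<forall>i\<in>I - J. coord_avg F i g = g \<or> coord_avg F i g = (\<lambda>x. 0)" for J g
    using finite_subset[OF that(1) \<open>finite I\<close>] that
  proof (induction J arbitrary: g rule: finite_induct)
    case empty
    then show ?case by (intro eig) simp
  next
    case (insert j J)
    define g1 where "g1 = coord_avg F j g"
    define g2 where "g2 = (\<lambda>x. g x - g1 x)"
    have "coord_avg F i g1 = g1 \<or> coord_avg F i g1 = (\<lambda>x. 0)" if "i \<in> I - J" for i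
    proof (cases "i = j")
      case True
      then show ?thesis by (simp add: g1_def coord_avg_idem[OF F])
    next
      case False
      then have "coord_avg F i g = g \<or> coord_avg F i g = (\<lambda>x. 0)"
        using insert.prems that by blast
      then show ?thesis
        unfolding g1_def coord_avg_commute[of F i j] by auto
    qed
    moreover have "coord_avg F i g2 = g2 \<or> coord_avg F i g2 = (\<lambda>x. 0)" if "i \<in> I - J" for i
    proof (cases "i = j")
      case True
      then show ?thesis by (simp add: g1_def g2_def coord_avg_diff coord_avg_idem[OF F])
    next
      case False
      then have "coord_avg F i g = g \<or> coord_avg F i g = (\<lambda>x. 0)"
        using insert.prems that by blast
      then show ?thesis
        unfolding g2_def g1_def coord_avg_diff coord_avg_commute[of F i j] by auto
    qed
    ultimately have "P (\<lambda>x. g1 x + g2 x)"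
      using insert.prems(1) by (intro add insert.IH) auto
    then show ?case by (simp add: g2_def)
  qed
  from this[of I] show ?thesis by simp
qed

section \<open>Arcs, degree and eigenvalues of the Hamming graph\<close>

lemma pverts_hamming_graph [simp]: "pverts (hamming_graph d F) = hamming_verts d F"
  by (simp add: hamming_graph_def)

lemma hamming_out_arcs:
  assumes x: "x \<in> hamming_verts d F"
  shows "{f \<in> parcs (hamming_graph d F). fst f = x}
       = (\<lambda>(i, a). (x, x(i := a))) ` (SIGMA i:{1..d}. F - {x i})" (is "?L = ?R")
proof
  show "?L \<subseteq> ?R"
  proof
    fix f assume "f \<in> ?L"
    then obtain y where f: "f = (x, y)" and y: "y \<in> hamming_verts d F"
      and "card {i \<in> {1..d}. x i \<noteq> y i} = 1"
      by (cases f) (auto simp: hamming_graph_def)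
    then obtain i where i: "{i \<in> {1..d}. x i \<noteq> y i} = {i}"
      by (auto simp: card_1_singleton_iff)
    then have "i \<in> {1..d}" "x i \<noteq> y i" and other: "\<And>j. j \<in> {1..d} \<Longrightarrow> j \<noteq> i \<Longrightarrow> x j = y j"
      by blast+
    \<comment> \<open>Outside \<open>{1..d}\<close> both functions are undefined by
      extensionality.\<close>
    have "y = x(i := y i)"
    proof
      fix j show "y j = (x(i := y i)) j"
        using other[of j] x y by (cases "j \<in> {1..d}") (auto simp: hamming_verts_def PiE_def extensional_def)
    qed
    moreover have "y i \<in> F" using y \<open>i \<in> {1..d}\<close> by (auto simp: hamming_verts_def)
    ultimately show "f \<in> ?R"
      using f \<open>i \<in> {1..d}\<close> \<open>x i \<noteq> y i\<close> by (intro image_eqI[of _ _ "(i, y i)"]) auto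
  qed
  show "?R \<subseteq> ?L"
  proof
    fix f assume "f \<in> ?R"
    then obtain p where p: "p \<in> (SIGMA i:{1..d}. F - {x i})" "f = (case p of (i, a) \<Rightarrow> (x, x(i := a)))"
      by (rule imageE)
    obtain i a where ia: "p = (i, a)" by (cases p)
    have f: "f = (x, x(i := a))" and i: "i \<in> {1..d}" and a: "a \<in> F" "a \<noteq> x i"
      using p by (simp_all add: ia)
    have "{j \<in> {1..d}. x j \<noteq> (x(i := a)) j} = {i}"
      using i a by auto
    moreover have "x(i := a) \<in> hamming_verts d F"
      using x i a by (auto simp: hamming_verts_def PiE_def extensional_def Pi_def)
    ultimately show "f \<in> ?L"
      using f x by (simp add: hamming_graph_def)
  qed
qed

lemma inj_on_coord_update:
  "inj_on (\<lambda>(i, a). (x, x(i := a))) (SIGMA i:I. F - {x i})"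
proof -
  have "i = j \<and> a = b" if eq: "x(i := a) = x(j := b)" and "a \<noteq> x i" for i j a b
  proof -
    have "i = j"
      using fun_cong[OF eq, of i] \<open>a \<noteq> x i\<close> by (auto split: if_splits)
    with fun_cong[OF eq, of i] show ?thesis by simp
  qed
  then show ?thesis by (auto simp: inj_on_def)
qed

lemma hamming_out_degree:
  assumes "finite F" and "x \<in> hamming_verts d F"
  shows "out_degree (with_proj (hamming_graph d F)) x = d * (card F - 1)"
proof -
  have "out_degree (with_proj (hamming_graph d F)) x = card (SIGMA i:{1..d}. F - {x i})"
    using assms(2)
    by (simp add: out_degree_def out_arcs_def hamming_out_arcs card_image[OF inj_on_coord_update])
  also have "\<dots> = (\<Sum>i\<in>{1..d}. card (F - {x i}))"
    using assms(1) by simp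
  also have "\<dots> = (\<Sum>i\<in>{1..d}. card F - 1)"
    using assms by (intro sum.cong card_Diff_singleton) (auto simp: hamming_verts_def)
  finally show ?thesis by simp
qed

text \<open>Adding the missing value \<open>x i\<close> completes the sum along coordinate
  \<open>i\<close> to \<open>card F\<close> times the average.\<close>

lemma hamming_neighbour_sum:
  assumes F: "finite F" "F \<noteq> {}" and x: "x \<in> hamming_verts d F"
  shows "(\<Sum>f\<in>{f \<in> parcs (hamming_graph d F). fst f = x}. g (snd f))
       = (\<Sum>i\<in>{1..d}. card F * coord_avg F i g x - g x)"
proof -
  have "(\<Sum>f\<in>{f \<in> parcs (hamming_graph d F). fst f = x}. g (snd f))
      = (\<Sum>(i, a)\<in>(SIGMA i:{1..d}. F - {x i}). g (x(i := a)))"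
    unfolding hamming_out_arcs[OF x] sum.reindex[OF inj_on_coord_update]
    by (simp add: case_prod_unfold)
  also have "\<dots> = (\<Sum>i\<in>{1..d}. \<Sum>a\<in>F - {x i}. g (x(i := a)))"
    using F by (subst sum.Sigma) auto
  also have "\<dots> = (\<Sum>i\<in>{1..d}. card F * coord_avg F i g x - g x)"
  proof (rule sum.cong[OF refl])
    fix i assume "i \<in> {1..d}"
    then have "x i \<in> F" using x by (auto simp: hamming_verts_def)
    then show "(\<Sum>a\<in>F - {x i}. g (x(i := a))) = card F * coord_avg F i g x - g x"
      using F by (simp add: coord_avg_def sum_diff1)
  qed
  finally show ?thesis .
qed

lemma regular_pair_graph_hamming:
  assumes "finite F" and "card F \<ge> 2" and "d \<ge> 1"
  shows "regular_pair_graph (hamming_graph d F) (d * (card F - 1))"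
proof -
  interpret pair_graph "hamming_graph d F"
    using assms(1) by (rule pair_graph_hamming_graph)
  show ?thesis
    using assms by unfold_locales (simp_all add: hamming_out_degree)
qed

text \<open>Each coordinate in \<open>S\<close> contributes -1 to the eigenvalue, every other one
  \<open>card F - 1\<close>.\<close>

lemma hamming_eigenfun:
  assumes "finite F" and "card F \<ge> 2" and "d \<ge> 1" and S: "S \<subseteq> {1..d}"
    and g: "\<And>i. i \<in> {1..d} \<Longrightarrow> coord_avg F i g = (if i \<in> S then (\<lambda>x. 0) else g)"
  shows "regular_pair_graph.eigenfun (hamming_graph d F)
           (real (card F) * (real d - real (card S)) - real d) g"
proof -
  interpret regular_pair_graph "hamming_graph d F" "d * (card F - 1)"
    using assms(1-3) by (rule regular_pair_graph_hamming)
  have "(\<Sum>f\<in>{f \<in> parcs (hamming_graph d F). fst f = x}. g (snd f))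
      = (real (card F) * (real d - real (card S)) - real d) * g x"
    if "x \<in> pverts (hamming_graph d F)" for x
  proof -
    have x: "x \<in> hamming_verts d F" using that by (simp add: hamming_graph_def)
    have "(\<Sum>f\<in>{f \<in> parcs (hamming_graph d F). fst f = x}. g (snd f))
        = (\<Sum>i\<in>{1..d}. card F * coord_avg F i g x - g x)"
      using assms x by (intro hamming_neighbour_sum) auto
    also have "\<dots> = (\<Sum>i\<in>{1..d}. (if i \<in> {1..d} - S then card F * g x else 0) - g x)"
      by (intro sum.cong) (auto simp: g)
    also have "\<dots> = (\<Sum>i\<in>{1..d} - S. card F * g x) - d * g x"
      unfolding sum_subtractf
      by (subst sum.mono_neutral_cong_right[of "{1..d}" "{1..d} - S" _ "\<lambda>_. card F * g x"]) auto
    also have "\<dots> = card ({1..d} - S) * (card F * g x) - d * g x"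
      by simp
    also have "real (card ({1..d} - S)) = real d - real (card S)"
      using S card_mono[OF _ S] by (simp add: card_Diff_subset finite_subset of_nat_diff)
    finally show ?thesis by (simp add: algebra_simps)
  qed
  then show ?thesis by (simp add: eigenfun_def)
qed

section \<open>Necessity and sufficiency of the listed parameters\<close>

lemma hamming_periodic_imp_dvd:
  assumes F: "finite F" "card F \<ge> 2" and d: "d \<ge> 1"
    and "grover_periodic (hamming_graph d F)"
  shows "d * (card F - 1) dvd 2 * card F"
proof -
  let ?k = "d * (card F - 1)"
  interpret regular_pair_graph "hamming_graph d F" ?k
    using F d by (rule regular_pair_graph_hamming)
  obtain n where "n > 0" and per: "\<And>\<psi>. arc_supported \<psi> \<Longrightarrow> (walk ^^ n) \<psi> = \<psi>"
    using assms(4) unfolding grover_periodic_iff by blast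
  then obtain m where m: "n = Suc m" by (cases n) auto
  obtain a b where ab: "a \<in> F" "b \<in> F" "a \<noteq> b"
    using F(2) by (metis card_le_Suc0_iff_eq F(1) not_less_eq_eq numeral_2_eq_2)
  define g :: "(nat \<Rightarrow> 'a) \<Rightarrow> real"
    where "g x = (if x 1 = a then 1 else 0) - (if x 1 = b then 1 else 0)" for x
  \<comment> \<open>Chosen so that \<open>?k * x / 2 = ?k - card F\<close>, the eigenvalue for
    \<open>S = {1}\<close>.\<close>
  define x :: real where "x = 2 - 2 * real (card F) / real ?k"
  have k: "real ?k = real d * (real (card F) - 1)" "real ?k > 0"
    using F(2) degree_pos by (simp_all add: of_nat_diff)
  have "coord_avg F i g = (if i \<in> {1} then (\<lambda>x. 0) else g)" for i
    using F ab by (auto simp: coord_avg_def g_def fun_eq_iff sum_subtractf)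
  then have "eigenfun (real (card F) * (real d - real (card {1::nat})) - real d) g"
    using F d by (intro hamming_eigenfun) auto
  moreover have "real (card F) * (real d - real (card {1::nat})) - real d = real ?k * x / 2"
  proof -
    have "real ?k * x / 2 = real ?k - real (card F)"
      unfolding x_def using k(2) by (simp add: field_simps del: of_nat_mult)
    moreover have "real (card F) * (real d - real (card {1::nat})) - real d = real ?k - real (card F)"
      unfolding k(1) by (simp add: algebra_simps)
    ultimately show ?thesis by (simp only:)
  qed
  ultimately have eig: "eigenfun (real ?k * x / 2) g" by (simp only:)
  define u where "u = (\<lambda>i\<in>{1..d}. a)"
  define e where "e = (u, u(1 := b))"
  have "u \<in> hamming_verts d F"
    using ab by (auto simp: u_def hamming_verts_def)
  then have "e \<in> {f \<in> parcs (hamming_graph d F). fst f = u}"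
    unfolding hamming_out_arcs[OF \<open>u \<in> hamming_verts d F\<close>] e_def
    using ab d by (intro image_eqI[of _ _ "(1, b)"]) (auto simp: u_def)
  then have e: "e \<in> parcs (hamming_graph d F)" by simp
  have "lift_head g e = poly (vieta_poly (Suc m)) x * lift_tail g e
          + (- poly (vieta_poly m) x) * lift_head g e"
    using per[OF arc_supported_lift(1)] walk_funpow_lift_head[OF eig, of m] m by metis
  moreover have "lift_head g e = -1" "lift_tail g e = 1"
    using e ab d by (simp_all add: lift_head_def lift_tail_def) (simp_all add: e_def g_def u_def)
  ultimately have "poly (vieta_poly (Suc m)) x + poly (vieta_poly m) x + 1 = 0" by simp
  moreover have "x \<in> \<rat>" by (simp add: x_def)
  ultimately have "x \<in> \<int>" by (intro vieta_poly_sum_root_Ints)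
  then have "2 - x \<in> \<int>" by simp
  then obtain z where "2 * real (card F) / real ?k = of_int z"
    unfolding x_def by (auto elim: Ints_cases)
  then have "of_int (int (2 * card F)) = (of_int (int ?k * z) :: real)"
    using k(2) by (simp add: field_simps del: of_nat_mult) 
  then have "int (2 * card F) = int ?k * z"
    by (simp only: of_int_eq_iff)
  then have "int ?k dvd int (2 * card F)" by simp
  then show ?thesis by (simp only: of_nat_dvd_iff)
qed

text \<open>The numbers in \<open>spec\<close> are the values of \<open>x\<close> for joint
  eigenfunctions with \<open>card S = s\<close>. Such functions add up to every vertex function, so
  all lifts have period 12.\<close>

lemma hamming_periodicI:
  assumes F: "finite F" "card F \<ge> 2" and d: "d \<ge> 1"
    and spec: "\<And>s. s \<le> d \<Longrightarrow>
      2 * (real (card F) * (real d - real s) - real d) / real (d * (card F - 1)) \<in> {-2, -1, 0, 1, 2}"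
  shows "grover_periodic (hamming_graph d F)"
proof -
  let ?k = "d * (card F - 1)"
  interpret regular_pair_graph "hamming_graph d F" ?k
    using F d by (rule regular_pair_graph_hamming)
  have "(walk ^^ 12) (lift_head g) = lift_head g" for g
  proof (rule coord_avg_decomposition[where F = F and I = "{1..d}" and g = g])
    fix g h
    assume "(walk ^^ 12) (lift_head g) = lift_head g" "(walk ^^ 12) (lift_head h) = lift_head h"
    then show "(walk ^^ 12) (lift_head (\<lambda>x. g x + h x)) = lift_head (\<lambda>x. g x + h x)"
      unfolding lift_head_add
        lincomb_preservingD[OF lincomb_preserving_funpow[OF lincomb_preserving_walk]]
      by simp
  next
    fix g
    assume g: "\<forall>i\<in>{1..d}. coord_avg F i g = g \<or> coord_avg F i g = (\<lambda>x. 0)"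
    define S where "S = {i \<in> {1..d}. coord_avg F i g = (\<lambda>x. 0)}"
    define x where "x = 2 * (real (card F) * (real d - real (card S)) - real d) / real ?k"
    have "card S \<le> d"
      using card_mono[of "{1..d}" S] by (simp add: S_def subset_iff)
    then have "x \<in> {-2, -1, 0, 1, 2}"
      unfolding x_def by (rule spec)
    have "eigenfun (real (card F) * (real d - real (card S)) - real d) g"
      using F d g by (intro hamming_eigenfun) (auto simp: S_def)
    moreover have "real (card F) * (real d - real (card S)) - real d = real ?k * x / 2"
      using degree_pos unfolding x_def by (simp del: of_nat_mult)
    ultimately have "eigenfun (real ?k * x / 2) g"
      by (simp only:)
    then show "(walk ^^ 12) (lift_head g) = lift_head g"
      using \<open>x \<in> {-2, -1, 0, 1, 2}\<close> by (rule lift_head_period)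
  qed (use F in auto)
  then have "(walk ^^ 12) \<psi> = \<psi>" if "arc_supported \<psi>" for \<psi>
    using walk_funpow_eq_id[of 12] that by simp
  moreover have "(12::nat) > 0" by simp
  ultimately show ?thesis
    unfolding grover_periodic_iff by blast
qed

text \<open>With \<open>r = q - 1\<close>, \<open>d * r\<close> divides \<open>2 * r + 2\<close>, so
  \<open>r\<close> divides 2. Then \<open>d\<close> divides 4 if \<open>r = 1\<close>, and 3 if
  \<open>r = 2\<close>.\<close>

lemma mult_pred_dvd_double_imp:
  fixes d q :: nat
  assumes "d \<ge> 1" and "q \<ge> 2" and dvd: "d * (q - 1) dvd 2 * q"
  shows "(d, q) \<in> {(1, 2), (1, 3), (2, 2), (3, 3), (4, 2)}"
proof -
  obtain r where q: "q = Suc r" and "r \<ge> 1"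
    using assms(2) by (cases q) auto
  have dr: "d * r dvd 2 * r + 2"
    using dvd by (simp add: q)
  then have "r dvd 2 * r + 2"
    by (rule dvd_mult_right)
  then have "r dvd 2"
    by (metis dvd_add_right_iff dvd_triv_right)
  then have "r \<le> 2" by (rule dvd_imp_le) simp
  then consider "r = 1" | "r = 2"
    using \<open>r \<ge> 1\<close> by linarith
  then show ?thesis
  proof cases
    case 1
    then have d: "d dvd 4" using dr by simp
    then have "d \<le> 4" by (rule dvd_imp_le) simp
    then have "d \<in> {1, 2, 3, 4}" using assms(1) by auto
    then show ?thesis using d 1 q by auto
  next
    case 2
    then have d: "d * 2 dvd 6" using dr by simp
    then have "d * 2 \<le> 6" by (rule dvd_imp_le) simp
    then have "d \<in> {1, 2, 3}" using assms(1) by auto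
    then show ?thesis using d 2 q by auto
  qed
qed

theorem theorem1p3:
  fixes d q :: nat and F :: "'a set"
  assumes "d \<ge> 1" and "q \<ge> 2" and "finite F" and "card F = q"
  shows "grover_periodic (hamming_graph d F) \<longleftrightarrow>
         (d, q) \<in> {(1, 2), (1, 3), (2, 2), (3, 3), (4, 2)}"
proof
  assume "grover_periodic (hamming_graph d F)"
  then have "d * (q - 1) dvd 2 * q"
    using hamming_periodic_imp_dvd[of F d] assms by simp
  then show "(d, q) \<in> {(1, 2), (1, 3), (2, 2), (3, 3), (4, 2)}"
    using mult_pred_dvd_double_imp assms by blast
next
  assume dq: "(d, q) \<in> {(1, 2), (1, 3), (2, 2), (3, 3), (4, 2)}"
  show "grover_periodic (hamming_graph d F)"
  proof (rule hamming_periodicI)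
    fix s assume "s \<le> d"
    \<comment> \<open>The value is \<open>2 - s * (2 * q / (d * (q - 1)))\<close>, and the factor of
      \<open>s\<close> is 4, 3, 2, 1, 1 for the five pairs in order.\<close>
    then have "s \<in> {0, 1, 2, 3, 4}" and "s \<le> d" using dq by auto
    then show "2 * (real (card F) * (real d - real s) - real d) / real (d * (card F - 1))
      \<in> {-2, -1, 0, 1, 2}"
      using dq assms(4) by auto
  qed (use assms in auto)
qed

end
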